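(* Let $g:\mathbb{B}^n\to\mathbb{B}^n$ be a hyperbolic holomorphic self-map with Denjoy--Wolff point $\tau\in\partial\mathbb{B}^n$ and boundary dilation coefficient $\alpha\in(0,1)$. Suppose that: (a) for every $z_0\in\mathbb{B}^n$, the forward orbit $z_k=g^{\circ k}(z_0)$ converges to $\tau$ non-tangentially, in the sense that there exists $M>1$, depending possibly on $z_0$, such that $z_k\in K(\tau,M)$ for all sufficiently large $k$; (b) there exists a holomorphic function (Valiron linearizer) $h:\mathbb{B}^n\to\mathbb{H}$ satisfying $$h(g(z))=\alpha^{-1}h(z),\qquad z\in\mathbb{B}^n,$$ and, for every $M>1$, $$|h(z)|\asymp\frac{1}{|1-\langle z,\tau\rangle|}\qquad (z\to\tau,\ z\in K(\tau,M)),$$ where the comparison constants may depend on $M$. Then, for every $z_0,w\in\mathbb{B}^n$, $$\rho_{\mathbb{B}^n}\bigl(g^{\circ k}(z_0),w\bigr)=k\log\frac1\alpha+O(1),\qquad k\to\infty.$$ In particular, $g$ has an extremal hyperbolic rate.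
   Context: $\mathbb{B}^n=\{z\in\mathbb{C}^n:|z|<1\}$, $\mathbb{H}=\{z\in\mathbb{C}:\operatorname{Im}z>0\}$, $\langle z,w\rangle=\sum_{j=1}^n z_j\overline{w_j}$. $g^{\circ k}$ denotes the $k$-th iterate. The distance on the ball is $\rho_{\mathbb{B}^n}(z,w)=\inf_\gamma\int_\gamma\frac{2|d\xi|}{1-|\xi|^2}$ over rectifiable curves $\gamma$ in $\mathbb{B}^n$ joining $z$ to $w$; equivalently $\sinh\frac{\rho_{\mathbb{B}^n}(z,w)}{2}=\frac{|z-w|}{\sqrt{1-|z|^2}\sqrt{1-|w|^2}}$. For $\tau\in\partial\mathbb{B}^n$, $M>1$, the Korányi region is $K(\tau,M)=\{z\in\mathbb{B}^n:|1-\langle z,\tau\rangle|<M(1-|z|)\}$. A holomorphic self-map $g$ of $\mathbb{B}^n$ with no fixed point in $\mathbb{B}^n$ has a unique Denjoy--Wolff point $\tau\in\partial\mathbb{B}^n$ with $g^{\circ k}(z)\to\tau$ for all $z\in\mathbb{B}^n$; its boundary dilation coefficient at $\tau$ is $\alpha=\liminf_{z\to\tau}\frac{1-|g(z)|}{1-|z|}\in(0,1]$, and $g$ is hyperbolic if $\alpha<1$. $g$ has an extremal hyperbolic rate if $\rho_{\mathbb{B}^n}(g^{\circ k}(z_0),w)=k\log\frac1\alpha+O(1)$ as $k\to\infty$ for every $z_0,w\in\mathbb{B}^n$, where $O(1)$ is bounded independently of $k$ (possibly depending on $g,z_0,w$). $A\asymp B$ as $z\to\tau$, $z\in K(\tau,M)$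 means $A/B$ is bounded above and below by positive constants for $z\in K(\tau,M)$ sufficiently close to $\tau$. *)

theory Defs
  imports "HOL-Analysis.Analysis" "HOL-Library.Landau_Symbols"
begin

definition hermitian_inner :: "complex ^ 'n \<Rightarrow> complex ^ 'n \<Rightarrow> complex" where
  "hermitian_inner z w = (\<Sum>j\<in>UNIV. z $ j * cnj (w $ j))"

text \<open>Complex differentiability in several variables: the real Frechet derivative
  exists and is complex-linear.\<close>

definition holomorphic_fun_on :: "(complex ^ 'n \<Rightarrow> complex) \<Rightarrow> (complex ^ 'n) set \<Rightarrow> bool" where
  "holomorphic_fun_on f S \<longleftrightarrow>
     (\<forall>z\<in>S. \<exists>f'. (f has_derivative f') (at z within S) \<and> (\<forall>c v. f' (c *s v) = c * f' v))"

definition holomorphic_map_on :: "(complex ^ 'n \<Rightarrow> complex ^ 'm) \<Rightarrow> (complex ^ 'n) set \<Rightarrow> bool" where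
  "holomorphic_map_on f S \<longleftrightarrow> (\<forall>i. holomorphic_fun_on (\<lambda>z. f z $ i) S)"

definition holomorphic_self_map :: "(complex ^ 'n \<Rightarrow> complex ^ 'n) \<Rightarrow> bool" where
  "holomorphic_self_map g \<longleftrightarrow> holomorphic_map_on g (ball 0 1) \<and> g ` ball 0 1 \<subseteq> ball 0 1"

text \<open>Lengths of polygons inscribed in the restriction of a curve to an interval;
  the curve is rectifiable if these are bounded, and its arc length is their supremum.\<close>

definition inscribed_lengths ::
  "(real \<Rightarrow> 'a::metric_space) \<Rightarrow> real \<Rightarrow> real \<Rightarrow> real set" where
  "inscribed_lengths \<gamma> a b =
     {\<Sum>i<m. dist (\<gamma> (t i)) (\<gamma> (t (Suc i))) | (t :: nat \<Rightarrow> real) m.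
        t ` {..m} \<subseteq> {a..b} \<and> mono_on {..m} t}"

definition rectifiable_path :: "(real \<Rightarrow> 'a::metric_space) \<Rightarrow> bool" where
  "rectifiable_path \<gamma> \<longleftrightarrow> path \<gamma> \<and> bdd_above (inscribed_lengths \<gamma> 0 1)"

definition arc_length_fun :: "(real \<Rightarrow> 'a::metric_space) \<Rightarrow> real \<Rightarrow> real" where
  "arc_length_fun \<gamma> t = Sup (inscribed_lengths \<gamma> 0 (max 0 (min 1 t)))"

text \<open>The integral with respect to arc length is the Lebesgue--Stieltjes integral against
  the arc length function, which is constant outside the unit interval; it makes sense for
  every rectifiable curve, without differentiability.\<close>

definition arc_length_integral ::
  "(real \<Rightarrow> 'a::metric_space) \<Rightarrow> ('a \<Rightarrow> real) \<Rightarrow> real" where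
  "arc_length_integral \<gamma> f = (LINT t:{0..1}|interval_measure (arc_length_fun \<gamma>). f (\<gamma> t))"

definition ball_dist :: "complex ^ 'n \<Rightarrow> complex ^ 'n \<Rightarrow> real" where
  "ball_dist z w =
     Inf {arc_length_integral \<gamma> (\<lambda>\<xi>. 2 / (1 - (norm \<xi>)\<^sup>2)) | \<gamma>.
       rectifiable_path \<gamma> \<and> path_image \<gamma> \<subseteq> ball 0 1 \<and> pathstart \<gamma> = z \<and> pathfinish \<gamma> = w}"

definition koranyi_region :: "complex ^ 'n \<Rightarrow> real \<Rightarrow> (complex ^ 'n) set" where
  "koranyi_region \<tau> M =
     {z \<in> ball 0 1. cmod (1 - hermitian_inner z \<tau>) < M * (1 - norm z)}"

definition denjoy_wolff_point :: "(complex ^ 'n \<Rightarrow> complex ^ 'n) \<Rightarrow> complex ^ 'n \<Rightarrow> bool" where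
  "denjoy_wolff_point g \<tau> \<longleftrightarrow>
     holomorphic_self_map g \<and> (\<forall>z\<in>ball 0 1. g z \<noteq> z) \<and>
     norm \<tau> = 1 \<and> (\<forall>z\<in>ball 0 1. (\<lambda>k. (g ^^ k) z) \<longlonglongrightarrow> \<tau>)"

definition boundary_dilation :: "(complex ^ 'n \<Rightarrow> complex ^ 'n) \<Rightarrow> complex ^ 'n \<Rightarrow> ereal" where
  "boundary_dilation g \<tau> =
     Liminf (at \<tau> within ball 0 1) (\<lambda>z. ereal ((1 - norm (g z)) / (1 - norm z)))"

definition hyperbolic_self_map :: "(complex ^ 'n \<Rightarrow> complex ^ 'n) \<Rightarrow> bool" where
  "hyperbolic_self_map g \<longleftrightarrow> (\<exists>\<tau>. denjoy_wolff_point g \<tau> \<and> boundary_dilation g \<tau> < 1)"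

text \<open>The point \<open>\<tau>\<close>, and hence \<open>\<alpha>\<close>, is determined by \<open>g\<close>, since limits are unique.\<close>

definition extremal_hyperbolic_rate :: "(complex ^ 'n \<Rightarrow> complex ^ 'n) \<Rightarrow> bool" where
  "extremal_hyperbolic_rate g \<longleftrightarrow>
     (\<exists>\<tau> \<alpha>. denjoy_wolff_point g \<tau> \<and> boundary_dilation g \<tau> = ereal \<alpha> \<and>
        (\<forall>z0\<in>ball 0 1. \<forall>w\<in>ball 0 1.
           (\<lambda>k. ball_dist ((g ^^ k) z0) w - real k * ln (1 / \<alpha>)) \<in> O(\<lambda>_. 1)))"

text \<open>The last conjunct is the comparability of \<open>|h(z)|\<close> with \<open>1 / |1 - \<langle>z,\<tau>\<rangle>|\<close>
  near \<open>\<tau>\<close> in each Koranyi region; its constants may depend on \<open>M\<close>.\<close>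

definition valiron_linearizer ::
  "(complex ^ 'n \<Rightarrow> complex ^ 'n) \<Rightarrow> complex ^ 'n \<Rightarrow> real \<Rightarrow> (complex ^ 'n \<Rightarrow> complex) \<Rightarrow> bool" where
  "valiron_linearizer g \<tau> \<alpha> h \<longleftrightarrow>
     holomorphic_fun_on h (ball 0 1) \<and>
     (\<forall>z\<in>ball 0 1. Im (h z) > 0) \<and>
     (\<forall>z\<in>ball 0 1. h (g z) = of_real (inverse \<alpha>) * h z) \<and>
     (\<forall>M>1. (\<lambda>z. cmod (h z))
        \<in> \<Theta>[at \<tau> within koranyi_region \<tau> M](\<lambda>z. 1 / cmod (1 - hermitian_inner z \<tau>)))"

end

theory Submission
  imports Defs
begin

text \<open>The hyperbolic distance from \<open>z\<close> to a fixed \<open>w\<close> is \<open>2 artanh |z|\<close> up to an error of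
  \<open>2 artanh |w|\<close> (lemma \<open>ball_dist_radial\<close>), and \<open>2 artanh r = - ln (1 - r) + O(1)\<close>.  So the
  assertion says that \<open>1 - |g\<^sup>k(z0)|\<close> is comparable to \<open>\<alpha>\<^sup>k\<close>, and this is what the
  linearizer provides (lemma \<open>orbit_boundary_rate\<close>): \<open>|h|\<close> grows along the orbit exactly
  by the factor \<open>1/\<alpha>\<close> per step, \<open>h\<close> does not vanish because its values lie in the upper half
  plane, and near \<open>\<tau>\<close> in a Koranyi region \<open>|h(z)|\<close>, \<open>1 / |1 - \<langle>z,\<tau>\<rangle>|\<close> and \<open>1 / (1 - |z|)\<close> are mutually
  comparable, the last two because \<open>1 - |z| \<le> |1 - \<langle>z,\<tau>\<rangle>| < M (1 - |z|)\<close>.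

  The analytic work lies in the distance estimate, as the distance is an infimum over all
  rectifiable curves of a Stieltjes integral.  From below, \<open>|\<gamma>|\<close> is 1-Lipschitz with respect to
  arc length and \<open>2 / (1 - r\<^sup>2)\<close> is the derivative of \<open>2 artanh r\<close>, so every curve has
  hyperbolic length at least the difference of the hyperbolic radii of its ends; from above,
  the broken line through the origin has hyperbolic length at most their sum.  Neither estimate
  differentiates the curve: both compare increments on short intervals
  (lemma \<open>increment_le_of_local\<close>).  The Stieltjes measure assigns to intervals the
  increments of the arc length function because that function is nondecreasing and
  right-continuous, which is why additivity and continuity of arc length have to be established.\<close>

section \<open>Arc length\<close>

definition arc_length :: "(real \<Rightarrow> 'a::metric_space) \<Rightarrow> real \<Rightarrow> real \<Rightarrow> real" where
  "arc_length \<gamma> a b = Sup (inscribed_lengths \<gamma> a b)"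

lemma inscribed_lengthsI:
  "t ` {..m} \<subseteq> {a..b} \<Longrightarrow> mono_on {..m} t \<Longrightarrow>
    (\<Sum>i<m. dist (\<gamma> (t i)) (\<gamma> (t (Suc i)))) \<in> inscribed_lengths \<gamma> a b"
  unfolding inscribed_lengths_def by blast

lemma inscribed_lengthsE:
  assumes "x \<in> inscribed_lengths \<gamma> a b"
  obtains t :: "nat \<Rightarrow> real" and m where "t ` {..m} \<subseteq> {a..b}" "mono_on {..m} t"
    "x = (\<Sum>i<m. dist (\<gamma> (t i)) (\<gamma> (t (Suc i))))"
  using assms unfolding inscribed_lengths_def by blast

lemma zero_in_inscribed_lengths: "a \<le> b \<Longrightarrow> 0 \<in> inscribed_lengths \<gamma> a b"
  using inscribed_lengthsI[of "\<lambda>_. a" 0 a b \<gamma>] by (simp add: mono_on_def)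

lemma dist_in_inscribed_lengths:
  assumes "a \<le> b" shows "dist (\<gamma> a) (\<gamma> b) \<in> inscribed_lengths \<gamma> a b"
proof -
  let ?t = "\<lambda>i::nat. if i = 0 then a else b"
  have "?t ` {..1} \<subseteq> {a..b}" "mono_on {..1} ?t"
    using assms by (auto simp: mono_on_def)
  from inscribed_lengthsI[OF this, of \<gamma>] show ?thesis by simp
qed

lemma inscribed_lengths_mono:
  "c \<le> a \<Longrightarrow> b \<le> d \<Longrightarrow> inscribed_lengths \<gamma> a b \<subseteq> inscribed_lengths \<gamma> c d"
  by (rule subsetI, erule inscribed_lengthsE) (auto intro!: inscribed_lengthsI)

lemma inscribed_lengths_concat:
  assumes "x \<in> inscribed_lengths \<gamma> a b" "y \<in> inscribed_lengths \<gamma> b c"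
  shows "\<exists>z\<in>inscribed_lengths \<gamma> a c. x + y \<le> z"
proof -
  obtain t m where t: "t ` {..m} \<subseteq> {a..b}" "mono_on {..m} t"
      "x = (\<Sum>i<m. dist (\<gamma> (t i)) (\<gamma> (t (Suc i))))"
    using assms(1) by (rule inscribed_lengthsE)
  obtain s n where s: "s ` {..n} \<subseteq> {b..c}" "mono_on {..n} s"
      "y = (\<Sum>i<n. dist (\<gamma> (s i)) (\<gamma> (s (Suc i))))"
    using assms(2) by (rule inscribed_lengthsE)
  define r where "r i = (if i \<le> m then t i else s (i - Suc m))" for i
  have t_in: "t i \<in> {a..b}" if "i \<le> m" for i using t(1) that by auto
  have s_in: "s i \<in> {b..c}" if "i \<le> n" for i using s(1) that by auto
  have bounds: "a \<le> b" "b \<le> c" using t_in[of 0] s_in[of 0] by auto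
  have "r i \<in> {a..c}" if "i \<le> m + Suc n" for i
    using t_in[of i] s_in[of "i - Suc m"] bounds that order_trans[OF bounds(1), of "s (i - Suc m)"]
      order_trans[OF _ bounds(2), of "t i"] by (cases "i \<le> m") (auto simp: r_def)
  hence r1: "r ` {..m + Suc n} \<subseteq> {a..c}" by auto
  have "r i \<le> r j" if "i \<le> j" "j \<le> m + Suc n" for i j
  proof -
    consider "j \<le> m" | "i \<le> m" "m < j" | "m < i" using that by linarith
    thus ?thesis
    proof cases
      case 1 thus ?thesis using that t(2) by (auto simp: r_def mono_on_def)
    next
      case 2
      have "t i \<le> b" "b \<le> s (j - Suc m)" using 2 that t_in[of i] s_in[of "j - Suc m"] by auto
      thus ?thesis using 2 by (simp add: r_def)
    next
      case 3
      have "s (i - Suc m) \<le> s (j - Suc m)"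
        by (rule mono_onD[OF s(2)]) (use that in auto)
      thus ?thesis using 3 that by (auto simp: r_def)
    qed
  qed
  hence r2: "mono_on {..m + Suc n} r" by (auto simp: mono_on_def)
  let ?d = "\<lambda>i. dist (\<gamma> (r i)) (\<gamma> (r (Suc i)))"
  have split: "(\<Sum>i<m + k. f i) = (\<Sum>i<m. f i) + (\<Sum>i<k. f (m + i))" for k and f :: "nat \<Rightarrow> real"
    by (induction k) auto
  have "(\<Sum>i<m + Suc n. ?d i) = (\<Sum>i<m. ?d i) + (?d m + (\<Sum>i<n. ?d (m + Suc i)))"
    unfolding split[of _ "Suc n"] by (simp only: sum.lessThan_Suc_shift add_0_right)
  also have "(\<Sum>i<m. ?d i) = x" unfolding t(3) by (intro sum.cong) (auto simp: r_def)
  also have "(\<Sum>i<n. ?d (m + Suc i)) = y" unfolding s(3) by (intro sum.cong) (auto simp: r_def)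
  finally have "x + y \<le> (\<Sum>i<m + Suc n. ?d i)" by simp
  thus ?thesis using inscribed_lengthsI[OF r1 r2] by blast
qed

text \<open>Clamping the partition points from above and from below at \<open>b\<close> yields partitions of the
  two halves.  An edge on one side of \<open>b\<close> survives in one half and collapses in the other, and
  an edge across \<open>b\<close> is handled by the triangle inequality, so no case distinction on the
  position of \<open>b\<close> among the partition points is needed.\<close>

lemma clamped_polygon_bound:
  fixes t :: "nat \<Rightarrow> real"
  assumes "mono_on {..m} t"
  shows "(\<Sum>i<m. dist (\<gamma> (t i)) (\<gamma> (t (Suc i)))) \<le>
    (\<Sum>i<m. dist (\<gamma> (min (t i) b)) (\<gamma> (min (t (Suc i)) b))) +
    (\<Sum>i<m. dist (\<gamma> (max (t i) b)) (\<gamma> (max (t (Suc i)) b)))"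
  unfolding sum.distrib[symmetric]
proof (rule sum_mono)
  fix i assume "i \<in> {..<m}"
  hence "t i \<le> t (Suc i)" using assms by (auto simp: mono_on_def)
  then consider "t (Suc i) \<le> b" | "b \<le> t i" | "t i \<le> b" "b \<le> t (Suc i)" by linarith
  thus "dist (\<gamma> (t i)) (\<gamma> (t (Suc i))) \<le> dist (\<gamma> (min (t i) b)) (\<gamma> (min (t (Suc i)) b)) +
      dist (\<gamma> (max (t i) b)) (\<gamma> (max (t (Suc i)) b))"
    using \<open>t i \<le> t (Suc i)\<close>
    by cases (auto simp: min_def max_def dist_triangle)
qed

lemma clamp_above_in_inscribed_lengths:
  assumes "t ` {..m} \<subseteq> {a..c}" "mono_on {..m} t" "a \<le> b"
  shows "(\<Sum>i<m. dist (\<gamma> (min (t i) b)) (\<gamma> (min (t (Suc i)) b))) \<in> inscribed_lengths \<gamma> a b"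
proof (rule inscribed_lengthsI[where t = "\<lambda>i. min (t i) b"])
  show "(\<lambda>i. min (t i) b) ` {..m} \<subseteq> {a..b}" using assms(1,3) by (auto simp: image_subset_iff)
  show "mono_on {..m} (\<lambda>i. min (t i) b)" using assms(2) unfolding mono_on_def by (meson min.mono order_refl)
qed

lemma clamp_below_in_inscribed_lengths:
  assumes "t ` {..m} \<subseteq> {a..c}" "mono_on {..m} t" "b \<le> c"
  shows "(\<Sum>i<m. dist (\<gamma> (max (t i) b)) (\<gamma> (max (t (Suc i)) b))) \<in> inscribed_lengths \<gamma> b c"
proof (rule inscribed_lengthsI[where t = "\<lambda>i. max (t i) b"])
  show "(\<lambda>i. max (t i) b) ` {..m} \<subseteq> {b..c}" using assms(1,3) by (auto simp: image_subset_iff)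
  show "mono_on {..m} (\<lambda>i. max (t i) b)" using assms(2) unfolding mono_on_def by (meson max.mono order_refl)
qed

lemma rectifiable_bdd:
  assumes "rectifiable_path \<gamma>" "0 \<le> a" "b \<le> 1"
  shows "bdd_above (inscribed_lengths \<gamma> a b)"
proof (rule bdd_above_mono)
  show "bdd_above (inscribed_lengths \<gamma> 0 1)" using assms by (simp add: rectifiable_path_def)
  show "inscribed_lengths \<gamma> a b \<subseteq> inscribed_lengths \<gamma> 0 1"
    using assms by (intro inscribed_lengths_mono)
qed

lemma arc_length_upper:
  assumes "rectifiable_path \<gamma>" "0 \<le> a" "b \<le> 1" "x \<in> inscribed_lengths \<gamma> a b"
  shows "x \<le> arc_length \<gamma> a b"
  unfolding arc_length_def by (intro cSup_upper assms rectifiable_bdd)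

lemma arc_length_nonneg:
  assumes "rectifiable_path \<gamma>" "0 \<le> a" "a \<le> b" "b \<le> 1"
  shows "0 \<le> arc_length \<gamma> a b"
  using assms arc_length_upper zero_in_inscribed_lengths by blast

lemma dist_le_arc_length:
  assumes "rectifiable_path \<gamma>" "0 \<le> a" "a \<le> b" "b \<le> 1"
  shows "dist (\<gamma> a) (\<gamma> b) \<le> arc_length \<gamma> a b"
  using assms arc_length_upper dist_in_inscribed_lengths by blast

lemma arc_length_least:
  assumes "a \<le> b" "\<And>x. x \<in> inscribed_lengths \<gamma> a b \<Longrightarrow> x \<le> u"
  shows "arc_length \<gamma> a b \<le> u"
  unfolding arc_length_def using assms zero_in_inscribed_lengths[of a b \<gamma>] by (intro cSup_least) auto

lemma arc_length_additive:
  assumes \<gamma>: "rectifiable_path \<gamma>" and ord: "0 \<le> a" "a \<le> b" "b \<le> c" "c \<le> 1"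
  shows "arc_length \<gamma> a c = arc_length \<gamma> a b + arc_length \<gamma> b c"
proof (rule antisym)
  show "arc_length \<gamma> a c \<le> arc_length \<gamma> a b + arc_length \<gamma> b c"
  proof (rule arc_length_least)
    fix x assume "x \<in> inscribed_lengths \<gamma> a c"
    then obtain t m where t: "t ` {..m} \<subseteq> {a..c}" "mono_on {..m} t"
      "x = (\<Sum>i<m. dist (\<gamma> (t i)) (\<gamma> (t (Suc i))))" by (rule inscribed_lengthsE)
    show "x \<le> arc_length \<gamma> a b + arc_length \<gamma> b c"
      using clamped_polygon_bound[OF t(2), of \<gamma> b] ord
        arc_length_upper[OF \<gamma> _ _ clamp_above_in_inscribed_lengths[OF t(1,2)], of b]
        arc_length_upper[OF \<gamma> _ _ clamp_below_in_inscribed_lengths[OF t(1,2)], of b]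
      unfolding t(3) by simp
  qed (use ord in simp)
next
  have "x + y \<le> arc_length \<gamma> a c"
    if "x \<in> inscribed_lengths \<gamma> a b" "y \<in> inscribed_lengths \<gamma> b c" for x y
    using inscribed_lengths_concat[OF that] arc_length_upper[OF \<gamma> _ _, of a c] ord order_trans by meson
  hence "y \<le> arc_length \<gamma> a c - x"
    if "x \<in> inscribed_lengths \<gamma> a b" "y \<in> inscribed_lengths \<gamma> b c" for x y
    using that by (simp add: le_diff_eq add.commute)
  hence "arc_length \<gamma> b c \<le> arc_length \<gamma> a c - x" if "x \<in> inscribed_lengths \<gamma> a b" for x
    using that ord by (intro arc_length_least) auto
  hence "arc_length \<gamma> a b \<le> arc_length \<gamma> a c - arc_length \<gamma> b c"
    using ord by (intro arc_length_least) (auto simp: le_diff_eq add.commute)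
  thus "arc_length \<gamma> a b + arc_length \<gamma> b c \<le> arc_length \<gamma> a c" by simp
qed

text \<open>A partition of \<open>[a,1]\<close> that nearly attains the length has a fixed number of edges, so by
  continuity its part inside a short initial interval \<open>[a,b]\<close> contributes almost nothing.
  Hence almost all the length lies in \<open>[b,1]\<close>.\<close>

lemma arc_length_small:
  assumes \<gamma>: "rectifiable_path \<gamma>" and a: "0 \<le> a" "a < 1" and \<epsilon>: "0 < \<epsilon>"
  shows "\<exists>b. a < b \<and> b \<le> 1 \<and> arc_length \<gamma> a b < \<epsilon>"
proof -
  have "\<not> arc_length \<gamma> a 1 \<le> arc_length \<gamma> a 1 - \<epsilon> / 2" using \<epsilon> by simp
  hence "\<exists>x\<in>inscribed_lengths \<gamma> a 1. arc_length \<gamma> a 1 - \<epsilon> / 2 < x"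
    using a arc_length_least[of a 1 \<gamma> "arc_length \<gamma> a 1 - \<epsilon> / 2"] by (meson less_imp_le not_le)
  then obtain x where x: "x \<in> inscribed_lengths \<gamma> a 1" and big: "arc_length \<gamma> a 1 - \<epsilon> / 2 < x"
    by blast
  obtain t m where t: "t ` {..m} \<subseteq> {a..1}" "mono_on {..m} t"
      and x_eq: "x = (\<Sum>i<m. dist (\<gamma> (t i)) (\<gamma> (t (Suc i))))"
    using x by (rule inscribed_lengthsE)
  define e where "e = \<epsilon> / (4 * (real m + 1))"
  have "e > 0" using \<epsilon> by (simp add: e_def)
  moreover have "continuous_on {0..1} \<gamma>" "a \<in> {0..1}"
    using \<gamma> a by (auto simp: rectifiable_path_def path_def)
  ultimately obtain d where d: "d > 0" "\<And>x. x \<in> {0..1} \<Longrightarrow> dist x a < d \<Longrightarrow> dist (\<gamma> x) (\<gamma> a) < e"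
    unfolding continuous_on_iff by meson
  define b where "b = min 1 (a + d / 2)"
  have b: "a < b" "b \<le> 1" "b < a + d" using d(1) a by (auto simp: b_def)
  have near: "dist (\<gamma> x) (\<gamma> a) < e" if "a \<le> x" "x \<le> b" for x
    using that b a by (intro d(2)) (auto simp: dist_real_def)
  have "dist (\<gamma> (min (t i) b)) (\<gamma> (min (t (Suc i)) b)) \<le> 2 * e" if "i < m" for i
  proof -
    have "t i \<ge> a" "t (Suc i) \<ge> a" using t(1) that by (auto simp: image_subset_iff)
    hence "dist (\<gamma> (min (t i) b)) (\<gamma> a) < e" "dist (\<gamma> (min (t (Suc i)) b)) (\<gamma> a) < e"
      using b by (auto intro!: near)
    thus ?thesis
      using dist_triangle2[of "\<gamma> (min (t i) b)" "\<gamma> (min (t (Suc i)) b)" "\<gamma> a"] by simp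
  qed
  hence "(\<Sum>i<m. dist (\<gamma> (min (t i) b)) (\<gamma> (min (t (Suc i)) b))) \<le> (\<Sum>i<m. 2 * e)"
    by (intro sum_mono) auto
  also have "\<dots> \<le> \<epsilon> / 2" using \<epsilon> by (simp add: e_def field_simps)
  finally have "arc_length \<gamma> a 1 - \<epsilon> / 2 < \<epsilon> / 2 + arc_length \<gamma> b 1"
    using clamped_polygon_bound[OF t(2), of \<gamma> b] big x_eq a b
      arc_length_upper[OF \<gamma> _ _ clamp_below_in_inscribed_lengths[OF t], of b] by simp
  hence "arc_length \<gamma> a b < \<epsilon>" using arc_length_additive[OF \<gamma>, of a b 1] a b by simp
  thus ?thesis using b by blast
qed

lemma arc_length_fun_increment:
  assumes "rectifiable_path \<gamma>" "0 \<le> s" "s \<le> t" "t \<le> 1"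
  shows "arc_length_fun \<gamma> t - arc_length_fun \<gamma> s = arc_length \<gamma> s t"
  using arc_length_additive[OF assms(1), of 0 s t] assms
  by (simp add: arc_length_fun_def arc_length_def)

lemma arc_length_fun_clamp: "arc_length_fun \<gamma> t = arc_length_fun \<gamma> (max 0 (min 1 t))"
  by (simp add: arc_length_fun_def)

lemma arc_length_fun_mono:
  assumes "rectifiable_path \<gamma>" "s \<le> t"
  shows "arc_length_fun \<gamma> s \<le> arc_length_fun \<gamma> t"
proof -
  let ?c = "\<lambda>t. max 0 (min 1 t) :: real"
  have "0 \<le> arc_length \<gamma> (?c s) (?c t)" using assms by (intro arc_length_nonneg) auto
  also have "\<dots> = arc_length_fun \<gamma> (?c t) - arc_length_fun \<gamma> (?c s)"
    using assms by (intro arc_length_fun_increment[symmetric]) auto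
  finally show ?thesis
    unfolding arc_length_fun_clamp[of \<gamma> s] arc_length_fun_clamp[of \<gamma> t] by linarith
qed

lemma arc_length_fun_right_continuous:
  assumes "rectifiable_path \<gamma>"
  shows "continuous (at_right a) (arc_length_fun \<gamma>)"
proof (subst continuous_at_right_real_increasing; (intro allI impI arc_length_fun_mono assms)?)
  fix \<epsilon> :: real assume \<epsilon>: "\<epsilon> > 0"
  consider "a < 0" | "1 \<le> a" | "0 \<le> a" "a < 1" by linarith
  thus "\<exists>\<delta>>0. arc_length_fun \<gamma> (a + \<delta>) - arc_length_fun \<gamma> a < \<epsilon>"
  proof cases
    case 1
    thus ?thesis using \<epsilon> by (intro exI[of _ "-a"]) (simp add: arc_length_fun_def)
  next
    case 2
    thus ?thesis using \<epsilon> by (intro exI[of _ 1]) (simp add: arc_length_fun_def)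
  next
    case 3
    then obtain b where "a < b" "b \<le> 1" "arc_length \<gamma> a b < \<epsilon>"
      using arc_length_small[OF assms] \<epsilon> by blast
    thus ?thesis
      using 3 arc_length_fun_increment[OF assms, of a b] by (intro exI[of _ "b - a"]) simp
  qed
qed

section \<open>Integrals against arc length\<close>

text \<open>The Stieltjes integral is accessible only through its partial integrals.  On an
  interval where the integrand varies little they grow almost proportionally to arc length.\<close>

lemma arc_length_integral_partial:
  assumes \<gamma>: "rectifiable_path \<gamma>" and cont: "continuous_on {0..1} (\<lambda>t. f (\<gamma> t))"
  obtains J where "arc_length_integral \<gamma> f = J 1 - J 0"
    and "\<And>s t c \<epsilon>. 0 \<le> s \<Longrightarrow> s \<le> t \<Longrightarrow> t \<le> 1 \<Longrightarrow> (\<And>x. x \<in> {s..t} \<Longrightarrow> \<bar>f (\<gamma> x) - c\<bar> \<le> \<epsilon>) \<Longrightarrow>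
      \<bar>J t - J s - c * arc_length \<gamma> s t\<bar> \<le> \<epsilon> * arc_length \<gamma> s t"
proof -
  define \<mu> where "\<mu> = interval_measure (arc_length_fun \<gamma>)"
  define J where "J t = (LINT x:{0..t}|\<mu>. f (\<gamma> x))" for t
  have sets: "sets \<mu> = sets borel" and space: "space \<mu> = UNIV" by (simp_all add: \<mu>_def)
  note Fmono = arc_length_fun_mono[OF \<gamma>] and Fcont = arc_length_fun_right_continuous[OF \<gamma>]
  have Ioc: "emeasure \<mu> {s<..t} = arc_length_fun \<gamma> t - arc_length_fun \<gamma> s" if "s \<le> t" for s t
    unfolding \<mu>_def using that Fmono Fcont by (rule emeasure_interval_measure_Ioc)
  have Ioc': "measure \<mu> {s<..t} = arc_length_fun \<gamma> t - arc_length_fun \<gamma> s" if "s \<le> t" for s t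
    unfolding \<mu>_def using that Fmono Fcont by (rule measure_interval_measure_Ioc)
  have "emeasure \<mu> {0..1} \<le> emeasure \<mu> {-1<..1}" by (intro emeasure_mono) (auto simp: sets)
  hence fin: "emeasure \<mu> {0..1} < \<infinity>" using Ioc[of "-1" 1] by (auto simp: less_top[symmetric] top_unique)
  have int_const: "set_integrable \<mu> {0..1} (\<lambda>_. b)" for b :: real
    using fin unfolding set_integrable_def by (intro integrable_scaleR_left) (auto simp: sets)
  have "bounded ((\<lambda>t. f (\<gamma> t)) ` {0..1})"
    by (intro compact_imp_bounded compact_continuous_image cont) auto
  then obtain B where B: "\<And>x. x \<in> {0..1} \<Longrightarrow> norm (f (\<gamma> x)) \<le> B"
    unfolding bounded_iff by blast
  have int: "set_integrable \<mu> {0..1} (\<lambda>t. f (\<gamma> t))"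
  proof (rule set_integrable_bound[OF int_const[of B]])
    show "set_borel_measurable \<mu> {0..1} (\<lambda>t. f (\<gamma> t))"
      using borel_measurable_continuous_on_indicator[OF _ cont]
      by (simp add: set_borel_measurable_def measurable_cong_sets[OF sets refl])
    show "AE x in \<mu>. x \<in> {0..1} \<longrightarrow> norm (f (\<gamma> x)) \<le> norm B" using B by (intro AE_I2) force
  qed
  have sub: "set_integrable \<mu> {s<..t} k" "set_integrable \<mu> {0..s} k"
    if "0 \<le> s" "s \<le> t" "t \<le> 1" "set_integrable \<mu> {0..1} k" for s t and k :: "real \<Rightarrow> real"
    using that by (auto intro!: set_integrable_subset[OF that(4)] simp: sets)
  \<comment> \<open>The arc length function is constant on the negative axis, so there is no atom at \<open>0\<close>.\<close>
  have "emeasure \<mu> {0} \<le> emeasure \<mu> {-1<..0}" by (intro emeasure_mono) (auto simp: sets)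
  hence "measure \<mu> {0} = 0" using Ioc[of "-1" 0] by (simp add: measure_def arc_length_fun_def)
  moreover have "J 0 = (LINT x:{0}|\<mu>. f (\<gamma> 0))"
    unfolding J_def set_lebesgue_integral_def
    by (intro Bochner_Integration.integral_cong) (auto simp: indicator_def)
  ultimately have J0: "J 0 = 0"
    by (simp add: set_lebesgue_integral_def space)
  show ?thesis
  proof
    show "arc_length_integral \<gamma> f = J 1 - J 0"
      using J0 by (simp add: arc_length_integral_def J_def \<mu>_def)
  next
    fix s t c \<epsilon> :: real
    assume st: "0 \<le> s" "s \<le> t" "t \<le> 1" and near: "\<And>x. x \<in> {s..t} \<Longrightarrow> \<bar>f (\<gamma> x) - c\<bar> \<le> \<epsilon>"
    have near': "c - \<epsilon> \<le> f (\<gamma> x)" "f (\<gamma> x) \<le> c + \<epsilon>" if "x \<in> {s<..t}" for x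
      using near[of x] that by (auto simp: abs_le_iff)
    have "{0..t} = {0..s} \<union> {s<..t}" using st by auto
    hence "J t = J s + (LINT x:{s<..t}|\<mu>. f (\<gamma> x))" unfolding J_def
      using set_integral_Un[of "{0..s}" "{s<..t}" \<mu> "\<lambda>x. f (\<gamma> x)"] sub[OF st int]
      by (simp add: disjoint_iff)
    moreover have const: "(LINT x:{s<..t}|\<mu>. b) = b * arc_length \<gamma> s t" for b :: real
      using Ioc'[of s t] st arc_length_fun_increment[OF \<gamma> st]
      by (simp add: set_lebesgue_integral_def space)
    moreover have "(LINT x:{s<..t}|\<mu>. f (\<gamma> x)) \<le> (LINT x:{s<..t}|\<mu>. c + \<epsilon>)"
      by (intro set_integral_mono sub[OF st int] sub[OF st int_const]) (use near' in fastforce)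
    moreover have "(LINT x:{s<..t}|\<mu>. c - \<epsilon>) \<le> (LINT x:{s<..t}|\<mu>. f (\<gamma> x))"
      by (intro set_integral_mono sub[OF st int] sub[OF st int_const]) (use near' in fastforce)
    ultimately show "\<bar>J t - J s - c * arc_length \<gamma> s t\<bar> \<le> \<epsilon> * arc_length \<gamma> s t"
      by (simp add: abs_le_iff algebra_simps)
  qed
qed

text \<open>This replaces differentiation in comparisons of increments, for functions such as arc
  length that need not be differentiable: errors that are small relative to the increments of
  some \<open>G\<close> telescope over a fine partition and vanish in the limit.\<close>

lemma increment_le_of_local:
  fixes H J G :: "real \<Rightarrow> real"
  assumes "\<And>\<epsilon>. \<epsilon> > 0 \<Longrightarrow> \<exists>\<delta>>0. \<forall>s t. 0 \<le> s \<and> s \<le> t \<and> t \<le> 1 \<and> t - s < \<delta> \<longrightarrow>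
    \<bar>H t - H s\<bar> \<le> J t - J s + \<epsilon> * (G t - G s)"
  shows "\<bar>H 1 - H 0\<bar> \<le> J 1 - J 0"
proof -
  have eps: "\<bar>H 1 - H 0\<bar> \<le> J 1 - J 0 + \<epsilon> * (G 1 - G 0)" if \<epsilon>: "\<epsilon> > 0" for \<epsilon>
  proof -
    obtain \<delta> where \<delta>: "\<delta> > 0" "\<And>s t. 0 \<le> s \<Longrightarrow> s \<le> t \<Longrightarrow> t \<le> 1 \<Longrightarrow> t - s < \<delta> \<Longrightarrow>
        \<bar>H t - H s\<bar> \<le> J t - J s + \<epsilon> * (G t - G s)"
      using assms[OF \<epsilon>] by blast
    obtain N where N: "inverse (real (Suc N)) < \<delta>" using reals_Archimedean[OF \<delta>(1)] by blast
    define p where "p k = real k / real (Suc N)" for k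
    have "\<bar>H (p k) - H (p 0)\<bar> \<le> J (p k) - J (p 0) + \<epsilon> * (G (p k) - G (p 0))" if "k \<le> Suc N" for k
      using that
    proof (induction k)
      case (Suc k)
      have "p (Suc k) - p k = inverse (real (Suc N))"
        by (simp add: p_def field_simps)
      moreover have "0 \<le> p k" "p k \<le> p (Suc k)" "p (Suc k) \<le> 1"
        using Suc.prems by (auto simp: p_def divide_right_mono)
      ultimately have "\<bar>H (p (Suc k)) - H (p k)\<bar> \<le>
          J (p (Suc k)) - J (p k) + \<epsilon> * (G (p (Suc k)) - G (p k))"
        using N by (intro \<delta>(2)) auto
      with Suc show ?case by (simp add: algebra_simps)
    qed simp
    from this[of "Suc N"] show ?thesis by (simp add: p_def)
  qed
  show ?thesis
  proof (rule field_le_epsilon)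
    fix e :: real assume e: "e > 0"
    define K where "K = \<bar>G 1 - G 0\<bar> + 1"
    have "e / K * (G 1 - G 0) \<le> e / K * K"
      using e by (intro mult_left_mono) (auto simp: K_def)
    also have "e / K * K = e" by (simp add: K_def)
    finally show "\<bar>H 1 - H 0\<bar> \<le> J 1 - J 0 + e"
      using eps[of "e / K"] e by (auto simp: K_def add_pos_pos intro: order_trans)
  qed
qed

lemma uniform_modulus:
  fixes \<phi> :: "real \<Rightarrow> real"
  assumes "continuous_on {0..1} \<phi>" "\<epsilon> > 0"
  obtains \<delta> where "\<delta> > 0"
    and "\<And>s t x y. 0 \<le> s \<Longrightarrow> t \<le> 1 \<Longrightarrow> t - s < \<delta> \<Longrightarrow> x \<in> {s..t} \<Longrightarrow> y \<in> {s..t} \<Longrightarrow> \<bar>\<phi> x - \<phi> y\<bar> \<le> \<epsilon>"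
proof -
  have "uniformly_continuous_on {0..1} \<phi>"
    using assms(1) by (intro compact_uniformly_continuous) auto
  then obtain \<delta> where "\<delta> > 0" "\<And>x y. x \<in> {0..1} \<Longrightarrow> y \<in> {0..1} \<Longrightarrow> dist x y < \<delta> \<Longrightarrow> dist (\<phi> x) (\<phi> y) < \<epsilon>"
    unfolding uniformly_continuous_on_def using assms(2) by metis
  note \<delta> = this
  show ?thesis
  proof (rule that[OF \<delta>(1)])
    fix s t x y :: real
    assume "0 \<le> s" "t \<le> 1" "t - s < \<delta>" "x \<in> {s..t}" "y \<in> {s..t}"
    hence "x \<in> {0..1}" "y \<in> {0..1}" "dist x y < \<delta>" by (auto simp: dist_real_def)
    from \<delta>(2)[OF this] show "\<bar>\<phi> x - \<phi> y\<bar> \<le> \<epsilon>" by (simp add: dist_real_def)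
  qed
qed

section \<open>The hyperbolic distance in terms of the radius\<close>

text \<open>\<open>2 * artanh r\<close> is the hyperbolic distance from the origin to a point of norm \<open>r\<close>;
  the density \<open>2 / (1 - r\<^sup>2)\<close> is its derivative.\<close>

lemma artanh_mean_value:
  fixes x y :: real
  assumes "\<bar>x\<bar> < 1" "\<bar>y\<bar> < 1"
  shows "\<exists>u\<in>closed_segment x y. 2 * artanh y - 2 * artanh x = 2 / (1 - u\<^sup>2) * (y - x)"
proof -
  have main: "\<exists>u\<in>{x..y}. 2 * artanh y - 2 * artanh x = 2 / (1 - u\<^sup>2) * (y - x)"
    if "x < y" "\<bar>x\<bar> < 1" "\<bar>y\<bar> < 1" for x y :: real
  proof -
    have "\<exists>u. x < u \<and> u < y \<and> 2 * artanh y - 2 * artanh x = (y - x) * (2 * (1 / (1 - u\<^sup>2)))"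
      using that by (intro MVT2[where f = "\<lambda>r. 2 * artanh r" and f' = "\<lambda>u. 2 * (1 / (1 - u\<^sup>2))"])
        (auto intro!: derivative_eq_intros artanh_real_has_field_derivative)
    thus ?thesis by (fastforce simp: mult.commute)
  qed
  consider "x = y" | "x < y" | "y < x" by linarith
  thus ?thesis
  proof cases
    case 1 thus ?thesis by auto
  next
    case 2 thus ?thesis using main assms by (simp add: closed_segment_eq_real_ivl)
  next
    case 3
    then obtain u where u: "u \<in> {y..x}" "2 * artanh x - 2 * artanh y = 2 / (1 - u\<^sup>2) * (x - y)"
      using main[of y x] assms by auto
    have "2 * artanh y - 2 * artanh x = 2 / (1 - u\<^sup>2) * (y - x)"
      using u(2) by (simp only: right_diff_distrib)
    thus ?thesis using 3 u(1) by (auto simp: closed_segment_eq_real_ivl)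
  qed
qed

text \<open>The intermediate radius of the mean value theorem is attained at a time between \<open>s\<close> and
  \<open>t\<close>, so the density there is one of the values that the integrand takes on \<open>[s,t]\<close>.\<close>

lemma artanh_increment_along:
  fixes \<rho> :: "real \<Rightarrow> real"
  assumes "continuous_on {0..1} \<rho>" "\<And>x. x \<in> {0..1} \<Longrightarrow> \<bar>\<rho> x\<bar> < 1" "0 \<le> s" "s \<le> t" "t \<le> 1"
  obtains u where "u \<in> {s..t}" "2 * artanh (\<rho> t) - 2 * artanh (\<rho> s) = 2 / (1 - (\<rho> u)\<^sup>2) * (\<rho> t - \<rho> s)"
proof -
  have "\<bar>\<rho> s\<bar> < 1" "\<bar>\<rho> t\<bar> < 1" using assms by auto
  then obtain v where v: "v \<in> closed_segment (\<rho> s) (\<rho> t)"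
      "2 * artanh (\<rho> t) - 2 * artanh (\<rho> s) = 2 / (1 - v\<^sup>2) * (\<rho> t - \<rho> s)"
    using artanh_mean_value by blast
  have "connected (\<rho> ` {s..t})"
    using assms by (intro connected_continuous_image continuous_on_subset[OF assms(1)]) auto
  hence "convex (\<rho> ` {s..t})" by (simp add: is_interval_connected_1[symmetric] is_interval_convex_1)
  hence "closed_segment (\<rho> s) (\<rho> t) \<subseteq> \<rho> ` {s..t}"
    using assms by (intro closed_segment_subset) auto
  thus ?thesis using v that by auto
qed

lemma hyperbolic_density_continuous:
  fixes \<gamma> :: "real \<Rightarrow> 'a::real_normed_vector"
  assumes "path \<gamma>" "path_image \<gamma> \<subseteq> ball 0 1"
  shows "continuous_on {0..1} (\<lambda>t. 2 / (1 - (norm (\<gamma> t))\<^sup>2))"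
proof -
  have "(norm (\<gamma> t))\<^sup>2 < 1" if "t \<in> {0..1}" for t
    using assms(2) that by (simp add: path_image_def image_subset_iff abs_square_less_1)
  thus ?thesis
    using assms(1) unfolding path_def by (intro continuous_intros) force+
qed

text \<open>Moving along a curve changes the norm by at most the arc length, so the hyperbolic radius
  changes by at most the hyperbolic length.\<close>

lemma hyperbolic_length_ge_radial:
  fixes \<gamma> :: "real \<Rightarrow> 'a::real_normed_vector"
  assumes \<gamma>: "rectifiable_path \<gamma>" and ball: "path_image \<gamma> \<subseteq> ball 0 1"
  shows "\<bar>2 * artanh (norm (\<gamma> 1)) - 2 * artanh (norm (\<gamma> 0))\<bar>
    \<le> arc_length_integral \<gamma> (\<lambda>\<xi>. 2 / (1 - (norm \<xi>)\<^sup>2))"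
proof -
  define \<phi> where "\<phi> t = 2 / (1 - (norm (\<gamma> t))\<^sup>2)" for t
  have "path \<gamma>" using \<gamma> by (simp add: rectifiable_path_def)
  hence cont: "continuous_on {0..1} \<phi>"
    unfolding \<phi>_def by (rule hyperbolic_density_continuous[OF _ ball])
  have norm1: "norm (\<gamma> t) < 1" if "t \<in> {0..1}" for t
    using ball that by (simp add: path_image_def image_subset_iff)
  have \<phi>_pos: "\<phi> t \<ge> 0" if "t \<in> {0..1}" for t
    using norm1[OF that] by (simp add: \<phi>_def power_le_one)
  obtain J where J: "arc_length_integral \<gamma> (\<lambda>\<xi>. 2 / (1 - (norm \<xi>)\<^sup>2)) = J 1 - J 0"
    and incr: "\<And>s t c \<epsilon>. 0 \<le> s \<Longrightarrow> s \<le> t \<Longrightarrow> t \<le> 1 \<Longrightarrow> (\<And>x. x \<in> {s..t} \<Longrightarrow> \<bar>\<phi> x - c\<bar> \<le> \<epsilon>) \<Longrightarrow>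
      \<bar>J t - J s - c * arc_length \<gamma> s t\<bar> \<le> \<epsilon> * arc_length \<gamma> s t"
    using arc_length_integral_partial[OF \<gamma>, of "\<lambda>\<xi>. 2 / (1 - (norm \<xi>)\<^sup>2)"] cont
    unfolding \<phi>_def by blast
  have "\<bar>2 * artanh (norm (\<gamma> 1)) - 2 * artanh (norm (\<gamma> 0))\<bar> \<le> J 1 - J 0"
  proof (rule increment_le_of_local[where G = "arc_length_fun \<gamma>"])
    fix \<epsilon> :: real assume "\<epsilon> > 0"
    from uniform_modulus[OF cont this] obtain \<delta> where \<delta>: "\<delta> > 0"
      "\<And>s t x y. 0 \<le> s \<Longrightarrow> t \<le> 1 \<Longrightarrow> t - s < \<delta> \<Longrightarrow> x \<in> {s..t} \<Longrightarrow> y \<in> {s..t} \<Longrightarrow> \<bar>\<phi> x - \<phi> y\<bar> \<le> \<epsilon>"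
      by metis
    have "\<bar>2 * artanh (norm (\<gamma> t)) - 2 * artanh (norm (\<gamma> s))\<bar>
        \<le> J t - J s + \<epsilon> * (arc_length_fun \<gamma> t - arc_length_fun \<gamma> s)"
      if st: "0 \<le> s" "s \<le> t" "t \<le> 1" "t - s < \<delta>" for s t
    proof -
      have "continuous_on {0..1} (\<lambda>t. norm (\<gamma> t))"
        using \<open>path \<gamma>\<close> unfolding path_def by (intro continuous_intros)
      moreover have "\<bar>norm (\<gamma> x)\<bar> < 1" if "x \<in> {0..1}" for x using norm1[OF that] by simp
      ultimately obtain u where u: "u \<in> {s..t}"
        "2 * artanh (norm (\<gamma> t)) - 2 * artanh (norm (\<gamma> s)) = \<phi> u * (norm (\<gamma> t) - norm (\<gamma> s))"
        unfolding \<phi>_def using st(1-3) by (rule artanh_increment_along)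
      have "\<bar>norm (\<gamma> t) - norm (\<gamma> s)\<bar> \<le> dist (\<gamma> s) (\<gamma> t)"
        unfolding dist_norm by (subst norm_minus_commute) (rule norm_triangle_ineq3)
      also have "\<dots> \<le> arc_length \<gamma> s t" using st by (intro dist_le_arc_length \<gamma>)
      finally have "\<phi> u * \<bar>norm (\<gamma> t) - norm (\<gamma> s)\<bar> \<le> \<phi> u * arc_length \<gamma> s t"
        using \<phi>_pos[of u] u(1) st by (intro mult_left_mono) auto
      moreover have "\<bar>J t - J s - \<phi> u * arc_length \<gamma> s t\<bar> \<le> \<epsilon> * arc_length \<gamma> s t"
        using st u(1) \<delta>(2)[of s t] by (intro incr) auto
      ultimately show ?thesis
        using \<phi>_pos[of u] u st by (simp add: abs_mult arc_length_fun_increment[OF \<gamma> st(1-3)])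
    qed
    thus "\<exists>\<delta>>0. \<forall>s t. 0 \<le> s \<and> s \<le> t \<and> t \<le> 1 \<and> t - s < \<delta> \<longrightarrow>
        \<bar>2 * artanh (norm (\<gamma> t)) - 2 * artanh (norm (\<gamma> s))\<bar>
          \<le> J t - J s + \<epsilon> * (arc_length_fun \<gamma> t - arc_length_fun \<gamma> s)"
      using \<delta>(1) by blast
  qed
  thus ?thesis using J by simp
qed

text \<open>Here \<open>\<rho>\<close> is a signed radius, increasing through \<open>0\<close> when the curve passes through the
  origin; the hypothesis on distances makes the curve run straight along radii.\<close>

lemma hyperbolic_length_le_radial:
  fixes \<gamma> :: "real \<Rightarrow> 'a::real_normed_vector"
  assumes cont\<gamma>: "path \<gamma>" and cont\<rho>: "continuous_on {0..1} \<rho>"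
    and norm\<gamma>: "\<And>t. t \<in> {0..1} \<Longrightarrow> norm (\<gamma> t) = \<bar>\<rho> t\<bar>" and \<rho>1: "\<And>t. t \<in> {0..1} \<Longrightarrow> \<bar>\<rho> t\<bar> < 1"
    and dist\<rho>: "\<And>s t. 0 \<le> s \<Longrightarrow> s \<le> t \<Longrightarrow> t \<le> 1 \<Longrightarrow> dist (\<gamma> s) (\<gamma> t) \<le> \<rho> t - \<rho> s"
  shows "rectifiable_path \<gamma>"
    and "arc_length_integral \<gamma> (\<lambda>\<xi>. 2 / (1 - (norm \<xi>)\<^sup>2)) \<le> 2 * artanh (\<rho> 1) - 2 * artanh (\<rho> 0)"
proof -
  have mono: "\<rho> s \<le> \<rho> t" if "0 \<le> s" "s \<le> t" "t \<le> 1" for s t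
    using dist\<rho>[OF that] zero_le_dist[of "\<gamma> s" "\<gamma> t"] by linarith
  have inscribed: "x \<le> \<rho> b - \<rho> a" if x: "x \<in> inscribed_lengths \<gamma> a b" and "0 \<le> a" "b \<le> 1" for x a b
  proof -
    obtain t m where t: "t ` {..m} \<subseteq> {a..b}" "mono_on {..m} t"
        "x = (\<Sum>i<m. dist (\<gamma> (t i)) (\<gamma> (t (Suc i))))"
      using x by (rule inscribed_lengthsE)
    have t_in: "a \<le> t i" "t i \<le> b" if "i \<le> m" for i
      using t(1) that by (auto simp: image_subset_iff)
    have "x \<le> (\<Sum>i<m. \<rho> (t (Suc i)) - \<rho> (t i))"
      unfolding t(3)
    proof (rule sum_mono)
      fix i assume "i \<in> {..<m}"
      hence "0 \<le> t i" "t i \<le> t (Suc i)" "t (Suc i) \<le> 1"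
        using t_in[of i] t_in[of "Suc i"] that t(2) by (auto simp: mono_on_def)
      thus "dist (\<gamma> (t i)) (\<gamma> (t (Suc i))) \<le> \<rho> (t (Suc i)) - \<rho> (t i)" by (rule dist\<rho>)
    qed
    also have "\<dots> = \<rho> (t m) - \<rho> (t 0)" by (rule sum_lessThan_telescope)
    also have "\<dots> \<le> \<rho> b - \<rho> a"
      using t_in[of 0] t_in[of m] that mono[of "t m" b] mono[of a "t 0"] by auto
    finally show ?thesis .
  qed
  show \<gamma>: "rectifiable_path \<gamma>"
    unfolding rectifiable_path_def
  proof
    show "bdd_above (inscribed_lengths \<gamma> 0 1)" by (rule bdd_aboveI[OF inscribed]) auto
  qed fact
  have arc\<rho>: "arc_length \<gamma> s t \<le> \<rho> t - \<rho> s" if "0 \<le> s" "s \<le> t" "t \<le> 1" for s t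
    using that inscribed by (intro arc_length_least) auto
  define \<phi> where "\<phi> t = 2 / (1 - (norm (\<gamma> t))\<^sup>2)" for t
  have "path_image \<gamma> \<subseteq> ball 0 1" using norm\<gamma> \<rho>1 by (auto simp: path_image_def)
  hence cont: "continuous_on {0..1} \<phi>"
    unfolding \<phi>_def by (rule hyperbolic_density_continuous[OF cont\<gamma>])
  have \<phi>_pos: "\<phi> t \<ge> 0" if "t \<in> {0..1}" for t
    using norm\<gamma>[OF that] \<rho>1[OF that] by (simp add: \<phi>_def abs_square_le_1)
  obtain J where J: "arc_length_integral \<gamma> (\<lambda>\<xi>. 2 / (1 - (norm \<xi>)\<^sup>2)) = J 1 - J 0"
    and incr: "\<And>s t c \<epsilon>. 0 \<le> s \<Longrightarrow> s \<le> t \<Longrightarrow> t \<le> 1 \<Longrightarrow> (\<And>x. x \<in> {s..t} \<Longrightarrow> \<bar>\<phi> x - c\<bar> \<le> \<epsilon>) \<Longrightarrow>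
      \<bar>J t - J s - c * arc_length \<gamma> s t\<bar> \<le> \<epsilon> * arc_length \<gamma> s t"
    using arc_length_integral_partial[OF \<gamma>, of "\<lambda>\<xi>. 2 / (1 - (norm \<xi>)\<^sup>2)"] cont
    unfolding \<phi>_def by blast
  have "\<bar>J 1 - J 0\<bar> \<le> 2 * artanh (\<rho> 1) - 2 * artanh (\<rho> 0)"
  proof (rule increment_le_of_local[where G = \<rho>])
    fix \<epsilon> :: real assume \<epsilon>: "\<epsilon> > 0"
    from uniform_modulus[OF cont this] obtain \<delta> where \<delta>: "\<delta> > 0"
      "\<And>s t x y. 0 \<le> s \<Longrightarrow> t \<le> 1 \<Longrightarrow> t - s < \<delta> \<Longrightarrow> x \<in> {s..t} \<Longrightarrow> y \<in> {s..t} \<Longrightarrow> \<bar>\<phi> x - \<phi> y\<bar> \<le> \<epsilon>"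
      by metis
    have "\<bar>J t - J s\<bar> \<le> 2 * artanh (\<rho> t) - 2 * artanh (\<rho> s) + \<epsilon> * (\<rho> t - \<rho> s)"
      if st: "0 \<le> s" "s \<le> t" "t \<le> 1" "t - s < \<delta>" for s t
    proof -
      obtain u where u: "u \<in> {s..t}"
        "2 * artanh (\<rho> t) - 2 * artanh (\<rho> s) = 2 / (1 - (\<rho> u)\<^sup>2) * (\<rho> t - \<rho> s)"
        using cont\<rho> \<rho>1 st(1-3) by (rule artanh_increment_along)
      have \<phi>u: "\<phi> u = 2 / (1 - (\<rho> u)\<^sup>2)" using norm\<gamma>[of u] u(1) st by (simp add: \<phi>_def)
      have "(\<phi> u + \<epsilon>) * arc_length \<gamma> s t \<le> (\<phi> u + \<epsilon>) * (\<rho> t - \<rho> s)"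
        using arc\<rho>[OF st(1-3)] \<phi>_pos[of u] u(1) st \<epsilon> by (intro mult_left_mono) auto
      moreover have "\<bar>J t - J s - \<phi> u * arc_length \<gamma> s t\<bar> \<le> \<epsilon> * arc_length \<gamma> s t"
        using st u(1) \<delta>(2)[of s t] by (intro incr) auto
      moreover have "0 \<le> \<phi> u * arc_length \<gamma> s t"
        using \<phi>_pos[of u] u(1) st arc_length_nonneg[OF \<gamma> st(1-3)] by auto
      moreover have "0 \<le> \<epsilon> * arc_length \<gamma> s t" using \<epsilon> arc_length_nonneg[OF \<gamma> st(1-3)] by simp
      ultimately show ?thesis
        unfolding u(2) \<phi>u[symmetric] abs_le_iff by (simp add: distrib_right)
    qed
    thus "\<exists>\<delta>>0. \<forall>s t. 0 \<le> s \<and> s \<le> t \<and> t \<le> 1 \<and> t - s < \<delta> \<longrightarrow>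
        \<bar>J t - J s\<bar> \<le> 2 * artanh (\<rho> t) - 2 * artanh (\<rho> s) + \<epsilon> * (\<rho> t - \<rho> s)"
      using \<delta>(1) by blast
  qed
  thus "arc_length_integral \<gamma> (\<lambda>\<xi>. 2 / (1 - (norm \<xi>)\<^sup>2)) \<le> 2 * artanh (\<rho> 1) - 2 * artanh (\<rho> 0)"
    using J by simp
qed

lemma path_through_origin:
  fixes z w :: "'a::real_normed_vector"
  assumes "norm z < 1" "norm w < 1"
  obtains \<gamma> where "rectifiable_path \<gamma>" "path_image \<gamma> \<subseteq> ball 0 1" "pathstart \<gamma> = z" "pathfinish \<gamma> = w"
    "arc_length_integral \<gamma> (\<lambda>\<xi>. 2 / (1 - (norm \<xi>)\<^sup>2)) \<le> 2 * artanh (norm z) + 2 * artanh (norm w)"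
proof -
  \<comment> \<open>At every time at least one of the two weights vanishes.\<close>
  define p where "p t = max 0 (1 - 2 * t)" for t :: real
  define q where "q t = max 0 (2 * t - 1)" for t :: real
  define \<gamma> where "\<gamma> t = p t *\<^sub>R z + q t *\<^sub>R w" for t
  define \<rho> where "\<rho> t = q t * norm w - p t * norm z" for t
  have cont: "path \<gamma>" "continuous_on {0..1} \<rho>"
    unfolding path_def \<gamma>_def \<rho>_def p_def q_def by (intro continuous_intros)+
  have normp: "norm (\<gamma> t) = \<bar>\<rho> t\<bar>" for t
    by (cases "t < 1 / 2") (auto simp: \<gamma>_def \<rho>_def p_def q_def abs_mult)
  have \<rho>1: "\<bar>\<rho> t\<bar> < 1" if "t \<in> {0..1}" for t
  proof -
    have *: "\<bar>c * norm v\<bar> < 1" if "0 \<le> c" "c \<le> 1" "norm v < 1" for c and v :: 'a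
      using that mult_left_le_one_le[of "norm v" c] by simp
    show ?thesis
    proof (cases "t \<le> 1 / 2")
      case True
      thus ?thesis using *[of "1 - 2 * t" z] that assms by (auto simp: \<rho>_def p_def q_def)
    next
      case False
      thus ?thesis using *[of "2 * t - 1" w] that assms by (auto simp: \<rho>_def p_def q_def)
    qed
  qed
  have dist\<rho>: "dist (\<gamma> s) (\<gamma> t) \<le> \<rho> t - \<rho> s" if "s \<le> t" for s t
  proof -
    have "\<gamma> s - \<gamma> t = (p s - p t) *\<^sub>R z - (q t - q s) *\<^sub>R w"
      by (simp add: \<gamma>_def algebra_simps)
    moreover have "0 \<le> p s - p t" "0 \<le> q t - q s" using that by (auto simp: p_def q_def)
    ultimately have "dist (\<gamma> s) (\<gamma> t) \<le> (p s - p t) * norm z + (q t - q s) * norm w"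
      using norm_triangle_ineq4[of "(p s - p t) *\<^sub>R z" "(q t - q s) *\<^sub>R w"] by (simp add: dist_norm)
    thus ?thesis by (simp add: \<rho>_def algebra_simps)
  qed
  note radial = hyperbolic_length_le_radial[OF cont normp \<rho>1 dist\<rho>]
  have ends: "\<rho> 0 = - norm z" "\<rho> 1 = norm w" by (auto simp: \<rho>_def p_def q_def)
  show ?thesis
  proof
    show "rectifiable_path \<gamma>" by (rule radial(1))
    show "path_image \<gamma> \<subseteq> ball 0 1" using normp \<rho>1 by (auto simp: path_image_def)
    show "pathstart \<gamma> = z" "pathfinish \<gamma> = w"
      by (auto simp: pathstart_def pathfinish_def \<gamma>_def p_def q_def)
    have "artanh (- norm z) = - artanh (norm z)" using assms by (intro artanh_minus_real) auto
    thus "arc_length_integral \<gamma> (\<lambda>\<xi>. 2 / (1 - (norm \<xi>)\<^sup>2)) \<le> 2 * artanh (norm z) + 2 * artanh (norm w)"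
      using radial(2) ends by simp
  qed
qed

text \<open>The path through the origin bounds the distance from above, the radial estimate for
  arbitrary curves bounds it from below; the bound does not depend on \<open>z\<close>.\<close>

lemma ball_dist_radial:
  fixes z w :: "complex ^ 'n"
  assumes "z \<in> ball 0 1" "w \<in> ball 0 1"
  shows "\<bar>ball_dist z w - 2 * artanh (norm z)\<bar> \<le> 2 * artanh (norm w)"
proof -
  let ?L = "{arc_length_integral \<gamma> (\<lambda>\<xi>. 2 / (1 - (norm \<xi>)\<^sup>2)) | \<gamma>.
       rectifiable_path \<gamma> \<and> path_image \<gamma> \<subseteq> ball 0 1 \<and> pathstart \<gamma> = z \<and> pathfinish \<gamma> = w}"
  obtain \<gamma> where \<gamma>: "rectifiable_path \<gamma>" "path_image \<gamma> \<subseteq> ball 0 1" "pathstart \<gamma> = z" "pathfinish \<gamma> = w"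
    "arc_length_integral \<gamma> (\<lambda>\<xi>. 2 / (1 - (norm \<xi>)\<^sup>2)) \<le> 2 * artanh (norm z) + 2 * artanh (norm w)"
    using path_through_origin[of z w] assms by auto
  have lower: "2 * artanh (norm z) - 2 * artanh (norm w) \<le> l" if "l \<in> ?L" for l
    using that hyperbolic_length_ge_radial by (fastforce simp: pathstart_def pathfinish_def)
  have "2 * artanh (norm z) - 2 * artanh (norm w) \<le> ball_dist z w"
    unfolding ball_dist_def by (rule cInf_greatest) (use \<gamma> lower in blast)+
  moreover have "ball_dist z w \<le> arc_length_integral \<gamma> (\<lambda>\<xi>. 2 / (1 - (norm \<xi>)\<^sup>2))"
    unfolding ball_dist_def
  proof (rule cInf_lower)
    show "bdd_below ?L" by (rule bdd_belowI[OF lower])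
  qed (use \<gamma> in blast)
  ultimately show ?thesis using \<gamma>(5) by linarith
qed

lemma artanh_approx_ln:
  fixes r :: real
  assumes "0 \<le> r" "r < 1"
  shows "\<bar>2 * artanh r + ln (1 - r)\<bar> \<le> ln 2"
proof -
  have "2 * artanh r + ln (1 - r) = ln (1 + r)"
    using assms by (simp add: artanh_def ln_div field_simps)
  moreover have "0 \<le> ln (1 + r)" "ln (1 + r) \<le> ln 2" using assms by (simp_all)
  ultimately show ?thesis by simp
qed

section \<open>Rate of approach to the boundary\<close>

lemma norm_hermitian_inner_le: "cmod (hermitian_inner z w) \<le> norm z * norm w"
proof -
  have "cmod (hermitian_inner z w) \<le> (\<Sum>j\<in>UNIV. \<bar>norm (z $ j)\<bar> * \<bar>norm (w $ j)\<bar>)"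
    unfolding hermitian_inner_def by (rule sum_norm_le) (simp add: norm_mult)
  also have "\<dots> \<le> norm z * norm w"
    unfolding norm_vec_def by (rule L2_set_mult_ineq)
  finally show ?thesis .
qed

lemma one_minus_norm_le:
  assumes "norm \<tau> = 1"
  shows "1 - norm z \<le> cmod (1 - hermitian_inner z \<tau>)"
  using norm_hermitian_inner_le[of z \<tau>] norm_triangle_ineq2[of 1 "hermitian_inner z \<tau>"] assms by simp

lemma denjoy_wolff_iterates_in_ball:
  assumes "denjoy_wolff_point g \<tau>" "z \<in> ball 0 1"
  shows "(g ^^ k) z \<in> ball 0 1"
proof (induction k)
  case (Suc k)
  have "g ` ball 0 1 \<subseteq> ball 0 1"
    using assms(1) by (simp add: denjoy_wolff_point_def holomorphic_self_map_def)
  hence "g ((g ^^ k) z) \<in> ball 0 1" using Suc by blast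
  thus ?case by simp
qed (use assms(2) in simp)

lemma bigtheta_ln_diff:
  fixes f g :: "nat \<Rightarrow> real"
  assumes "f \<in> \<Theta>(g)" "\<And>k. f k > 0" "\<And>k. g k > 0"
  shows "(\<lambda>k. ln (f k) - ln (g k)) \<in> O(\<lambda>_. 1)"
proof -
  obtain C where C: "C > 0" "eventually (\<lambda>k. norm (f k) \<le> C * norm (g k)) sequentially"
    using bigthetaD1[OF assms(1)] landau_o.bigE by blast
  obtain c where c: "c > 0" "eventually (\<lambda>k. norm (f k) \<ge> c * norm (g k)) sequentially"
    using bigthetaD2[OF assms(1)] landau_omega.bigE by blast
  show ?thesis
  proof (rule bigoI)
    show "eventually (\<lambda>k. norm (ln (f k) - ln (g k)) \<le> (\<bar>ln C\<bar> + \<bar>ln c\<bar>) * norm (1::real)) sequentially"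
      using C(2) c(2)
    proof eventually_elim
      case (elim k)
      hence "ln (f k) \<le> ln (C * g k)" "ln (c * g k) \<le> ln (f k)"
        using assms(2,3)[of k] c(1) C(1) by auto
      thus ?case using assms(3)[of k] c(1) C(1) by (simp add: ln_mult)
    qed
  qed
qed

text \<open>Along the orbit \<open>h\<close> is multiplied by \<open>1/\<alpha>\<close> at each step, and eventually \<open>|h|\<close> is
  comparable to \<open>1 / |1 - \<langle>z,\<tau>\<rangle>|\<close>, which in a Koranyi region is comparable to \<open>1 / (1 - |z|)\<close>.\<close>

lemma orbit_boundary_rate:
  fixes g :: "complex ^ 'n \<Rightarrow> complex ^ 'n"
  assumes dw: "denjoy_wolff_point g \<tau>" and \<alpha>: "0 < \<alpha>" and h: "valiron_linearizer g \<tau> \<alpha> h"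
    and M: "M > 1" "\<forall>\<^sub>F k in sequentially. (g ^^ k) z0 \<in> koranyi_region \<tau> M"
    and z0: "z0 \<in> ball 0 1"
  shows "(\<lambda>k. 1 - norm ((g ^^ k) z0)) \<in> \<Theta>(\<lambda>k. \<alpha> ^ k)"
proof -
  let ?z = "\<lambda>k. (g ^^ k) z0"
  define q where "q k = cmod (1 - hermitian_inner (?z k) \<tau>)" for k
  have \<tau>: "norm \<tau> = 1" and lim: "?z \<longlonglongrightarrow> \<tau>"
    using dw z0 by (auto simp: denjoy_wolff_point_def)
  have z: "?z k \<in> ball 0 1" for k by (rule denjoy_wolff_iterates_in_ball[OF dw z0])
  have h_eq: "h (g z) = of_real (inverse \<alpha>) * h z" and "Im (h z) > 0" if "z \<in> ball 0 1" for z
    using h that by (auto simp: valiron_linearizer_def)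
  have h0: "h z0 \<noteq> 0" using \<open>\<And>z. z \<in> ball 0 1 \<Longrightarrow> Im (h z) > 0\<close>[OF z0] by auto
  have hk: "cmod (h (?z k)) = inverse \<alpha> ^ k * cmod (h z0)" for k
    using \<alpha> by (induction k) (simp_all add: h_eq[OF z] norm_mult norm_inverse norm_power)
  have below: "1 - norm (?z k) \<le> q k" for k unfolding q_def by (rule one_minus_norm_le[OF \<tau>])
  have pos: "1 - norm (?z k) > 0" for k using z[of k] by simp
  have qpos: "q k > 0" for k using below[of k] pos[of k] by linarith
  have "?z k \<noteq> \<tau>" for k using z[of k] \<tau> by auto
  hence "filterlim ?z (at \<tau> within koranyi_region \<tau> M) sequentially"
    using lim M(2) unfolding filterlim_at by (auto elim: eventually_mono)
  moreover have "(\<lambda>z. cmod (h z)) \<in>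
      \<Theta>[at \<tau> within koranyi_region \<tau> M](\<lambda>z. 1 / cmod (1 - hermitian_inner z \<tau>))"
    using h M(1) by (auto simp: valiron_linearizer_def)
  ultimately have "(\<lambda>k. cmod (h (?z k))) \<in> \<Theta>(\<lambda>k. 1 / q k)"
    unfolding q_def by (rule landau_theta.compose[rotated])
  hence "(\<lambda>k. inverse \<alpha> ^ k) \<in> \<Theta>(\<lambda>k. inverse (q k))"
    using h0 by (simp add: hk inverse_eq_divide)
  hence "(\<lambda>k. inverse (inverse (q k))) \<in> \<Theta>(\<lambda>k. inverse (inverse \<alpha> ^ k))"
    using \<alpha> qpos by (intro landau_theta.inverse) (auto simp: less_imp_neq[symmetric])
  hence "q \<in> \<Theta>(\<lambda>k. \<alpha> ^ k)"
    by (simp add: power_inverse)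
  moreover have "(\<lambda>k. 1 - norm (?z k)) \<in> \<Theta>(q)"
  proof (rule bigthetaI'[of "1 / M" 1])
    show "eventually (\<lambda>k. 1 / M * norm (q k) \<le> norm (1 - norm (?z k)) \<and>
        norm (1 - norm (?z k)) \<le> 1 * norm (q k)) sequentially"
      using M(2)
    proof eventually_elim
      case (elim k)
      hence "q k < M * (1 - norm (?z k))" by (simp add: koranyi_region_def q_def)
      thus ?case using below[of k] pos[of k] qpos[of k] M(1) by (simp add: field_simps)
    qed
  qed (use M(1) in auto)
  ultimately show ?thesis by (rule landau_theta.trans[rotated])
qed

theorem theorem4p6:
  fixes g :: "complex ^ 'n \<Rightarrow> complex ^ 'n" and \<tau> :: "complex ^ 'n" and \<alpha> :: real
  assumes "hyperbolic_self_map g"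
    and "denjoy_wolff_point g \<tau>"
    and "boundary_dilation g \<tau> = ereal \<alpha>"
    and "0 < \<alpha>" and "\<alpha> < 1"
    and "\<forall>z0\<in>ball 0 1. \<exists>M>1. \<forall>\<^sub>F k in sequentially. (g ^^ k) z0 \<in> koranyi_region \<tau> M"
    and "\<exists>h. valiron_linearizer g \<tau> \<alpha> h"
  shows "(\<forall>z0\<in>ball 0 1. \<forall>w\<in>ball 0 1.
            (\<lambda>k. ball_dist ((g ^^ k) z0) w - real k * ln (1 / \<alpha>)) \<in> O(\<lambda>_. 1))
         \<and> extremal_hyperbolic_rate g"
proof -
  obtain h where h: "valiron_linearizer g \<tau> \<alpha> h" using assms(7) by blast
  have rate: "(\<lambda>k. ball_dist ((g ^^ k) z0) w - real k * ln (1 / \<alpha>)) \<in> O(\<lambda>_. 1)"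
    if z0: "z0 \<in> ball 0 1" and w: "w \<in> ball 0 1" for z0 w
  proof -
    let ?x = "\<lambda>k. 1 - norm ((g ^^ k) z0)"
    have z: "(g ^^ k) z0 \<in> ball 0 1" for k by (rule denjoy_wolff_iterates_in_ball[OF assms(2) z0])
    obtain M where M: "M > 1" "\<forall>\<^sub>F k in sequentially. (g ^^ k) z0 \<in> koranyi_region \<tau> M"
      using assms(6) z0 by blast
    have "?x \<in> \<Theta>(\<lambda>k. \<alpha> ^ k)" by (rule orbit_boundary_rate[OF assms(2,4) h M z0])
    hence "(\<lambda>k. ln (?x k) - ln (\<alpha> ^ k)) \<in> O(\<lambda>_. 1)"
      using z assms(4) by (intro bigtheta_ln_diff) auto
    moreover have "(\<lambda>k. ball_dist ((g ^^ k) z0) w + ln (?x k)) \<in> O(\<lambda>_. 1)"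
    proof (rule bigoI, rule always_eventually, rule allI)
      fix k
      show "norm (ball_dist ((g ^^ k) z0) w + ln (?x k))
          \<le> (2 * artanh (norm w) + ln 2) * norm (1::real)"
        using ball_dist_radial[OF z[of k] w] artanh_approx_ln[of "norm ((g ^^ k) z0)"] z[of k]
        by (simp add: abs_le_iff)
    qed
    ultimately have "(\<lambda>k. (ball_dist ((g ^^ k) z0) w + ln (?x k)) - (ln (?x k) - ln (\<alpha> ^ k)))
        \<in> O(\<lambda>_. 1)"
      by (rule sum_in_bigo(2)[rotated])
    thus ?thesis using assms(4) by (simp add: ln_div ln_realpow)
  qed
  thus ?thesis using assms(2,3) unfolding extremal_hyperbolic_rate_def by blast
qed

end
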